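(* For each integer $n\neq0$, there exists a map $\varphi_n:S^3\to S^2$ in the homotopy class $n[h]$ such that $\varphi_n^{-1}(y_0)=S_1$.
   Context: "Map" means continuous map. $S^3=\{(z_1,z_2)\in\mathbb{C}^2 : |z_1|^2+|z_2|^2=1\}$; the circle $S^1$ of unit complex numbers acts on $S^3$ by $(\lambda,(z_1,z_2))\mapsto(\lambda z_1,\lambda z_2)$; the orbit space $S^3/S^1=\mathbb{C}\mathrm{P}^1$ is identified with $S^2$; and the Hopf fibration $h:S^3\to S^2$ sends each point to the class of its orbit. The group $[S^3,S^2]=\pi_3(S^2)\approx\mathbb{Z}$ is generated by the homotopy class $[h]$, and $n[h]$ denotes the $n$-th multiple of $[h]$ in this group. The base point is $y_0=h(1,0)\in S^2$, and $S_1=\{(z_1,0)\in\mathbb{C}^2 : |z_1|=1\}\subset S^3$, so that $h^{-1}(y_0)=S_1$. *)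

theory Defs
  imports "HOL-Analysis.Analysis" "HOL-Algebra.Group"
begin

definition S3 :: "(complex \<times> complex) set" where
  "S3 = {(z1, z2). (cmod z1)\<^sup>2 + (cmod z2)\<^sup>2 = 1}"

definition S2 :: "(real ^ 3) set" where
  "S2 = sphere 0 1"

definition hopf_orbit :: "complex \<times> complex \<Rightarrow> (complex \<times> complex) set" where
  "hopf_orbit z = {(l * fst z, l * snd z) | l. cmod l = 1}"

definition orbit_space :: "(complex \<times> complex) set topology" where
  "orbit_space = topology (\<lambda>U. U \<subseteq> hopf_orbit ` S3 \<and>
     openin (top_of_set S3) {z \<in> S3. hopf_orbit z \<in> U})"

lemma openin_orbit_space:
  "openin orbit_space U \<longleftrightarrow>
     U \<subseteq> hopf_orbit ` S3 \<and> openin (top_of_set S3) {z \<in> S3. hopf_orbit z \<in> U}"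
proof -
  let ?L = "\<lambda>U. U \<subseteq> hopf_orbit ` S3 \<and> openin (top_of_set S3) {z \<in> S3. hopf_orbit z \<in> U}"
  have "istopology ?L"
    unfolding istopology_def
  proof (intro conjI allI impI)
    fix A B assume "?L A" "?L B"
    moreover have "{z \<in> S3. hopf_orbit z \<in> A \<inter> B} =
        {z \<in> S3. hopf_orbit z \<in> A} \<inter> {z \<in> S3. hopf_orbit z \<in> B}"
      by auto
    ultimately show "openin (top_of_set S3) {z \<in> S3. hopf_orbit z \<in> A \<inter> B}"
      by (metis (no_types, lifting) openin_Int)
  next
    fix K assume "\<forall>A\<in>K. ?L A"
    moreover have "{z \<in> S3. hopf_orbit z \<in> \<Union>K} = (\<Union>A\<in>K. {z \<in> S3. hopf_orbit z \<in> A})"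
      by auto
    ultimately show "openin (top_of_set S3) {z \<in> S3. hopf_orbit z \<in> \<Union>K}"
      by auto
  qed auto
  then show ?thesis
    unfolding orbit_space_def by (simp add: topology_inverse')
qed

definition cube :: "(real \<times> real \<times> real) set" where
  "cube = {0..1} \<times> {0..1} \<times> {0..1}"

definition cube_bd :: "(real \<times> real \<times> real) set" where
  "cube_bd = {(s, t, u) \<in> cube. s \<in> {0, 1} \<or> t \<in> {0, 1} \<or> u \<in> {0, 1}}"

definition spheroids :: "'a topology \<Rightarrow> 'a \<Rightarrow> (real \<times> real \<times> real \<Rightarrow> 'a) set" where
  "spheroids X x0 = {f. continuous_map (top_of_set cube) X f \<and> (\<forall>p \<in> cube_bd. f p = x0)}"

definition cube_class ::
    "'a topology \<Rightarrow> 'a \<Rightarrow> (real \<times> real \<times> real \<Rightarrow> 'a) \<Rightarrow> (real \<times> real \<times> real \<Rightarrow> 'a) set" where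
  "cube_class X x0 f =
     {g. homotopic_with (\<lambda>k. \<forall>p \<in> cube_bd. k p = x0) (top_of_set cube) X f g}"

definition cube_concat ::
    "(real \<times> real \<times> real \<Rightarrow> 'a) \<Rightarrow> (real \<times> real \<times> real \<Rightarrow> 'a) \<Rightarrow> real \<times> real \<times> real \<Rightarrow> 'a" where
  "cube_concat f g = (\<lambda>(s, t, u). if s \<le> 1/2 then f (2 * s, t, u) else g (2 * s - 1, t, u))"

text \<open>
  Homotopies are relative to the boundary of the cube. In the product, all the classes united are
  equal, since concatenation respects these homotopies.
\<close>

definition pi3 :: "'a topology \<Rightarrow> 'a \<Rightarrow> (real \<times> real \<times> real \<Rightarrow> 'a) set monoid" where
  "pi3 X x0 =
     \<lparr>carrier = cube_class X x0 ` spheroids X x0,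
      mult = \<lambda>A B. \<Union>f\<in>A. \<Union>g\<in>B. cube_class X x0 (cube_concat f g),
      one = cube_class X x0 (\<lambda>_. x0)\<rparr>"

text \<open>
  The identification of the cube modulo its boundary with \<open>S3\<close>: the homeomorphism
  \<open>v \<mapsto> v / b\<close> from the open cube with side \<open>(-1, 1)\<close> onto 3-space, followed by the inverse of the
  stereographic projection of \<open>S3\<close> from \<open>(1, 0)\<close>. The boundary of the cube, where \<open>b = 0\<close>, goes
  to \<open>(1, 0)\<close>.
\<close>

definition cube_to_S3 :: "real \<times> real \<times> real \<Rightarrow> complex \<times> complex" where
  "cube_to_S3 = (\<lambda>(s, t, u).
     let v1 = 2 * s - 1; v2 = 2 * t - 1; v3 = 2 * u - 1;
         b = (1 - v1\<^sup>2) * (1 - v2\<^sup>2) * (1 - v3\<^sup>2);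
         r = v1\<^sup>2 + v2\<^sup>2 + v3\<^sup>2;
         d = r + b\<^sup>2
     in (Complex ((r - b\<^sup>2) / d) (2 * b * v1 / d), Complex (2 * b * v2 / d) (2 * b * v3 / d)))"

text \<open>
  The free homotopy class of maps on \<open>S3\<close> given by an element of the third homotopy group. For
  simply connected \<open>X\<close> this is the identification of that group with \<open>[S3, X]\<close>.
\<close>

definition free_class ::
    "'a topology \<Rightarrow> (real \<times> real \<times> real \<Rightarrow> 'a) set \<Rightarrow> (complex \<times> complex \<Rightarrow> 'a) set" where
  "free_class X A =
     {f. \<exists>g. homotopic_with (\<lambda>_. True) (top_of_set S3) X f g \<and> g \<circ> cube_to_S3 \<in> A}"

end

theory Submission
  imports Defs
begin

text \<open>
  The wanted map is \<open>h\<close> after \<open>(z1, z2) \<mapsto> (z1, |z2| (z2/|z2|)^n)\<close>, a self-map of \<open>S3\<close> that preserves the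
  circle \<open>z2 = 0\<close> and its complement. Viewing \<open>S3\<close> as the unit quaternions, the sum in the third
  homotopy group is the pointwise product, so \<open>n[h]\<close> is the class of \<open>h\<close> after \<open>q \<mapsto> q^n\<close>. The two
  self-maps of \<open>S3\<close> are homotopic since the twisted maps multiply, up to homotopy, by adding exponents:
  deform the loops \<open>w^m\<close> and \<open>w^n\<close> until each is constant on one half of the circle. There the
  product of the corresponding maps, with the map of exponent \<open>0\<close> divided out in between, is exactly
  the map given by the product loop; and the map of exponent \<open>0\<close> is null-homotopic.
\<close>

subsection \<open>The third homotopy group\<close>

abbreviation cube_homotopic ::
    "'a topology \<Rightarrow> 'a \<Rightarrow> (real \<times> real \<times> real \<Rightarrow> 'a) \<Rightarrow> (real \<times> real \<times> real \<Rightarrow> 'a) \<Rightarrow> bool" where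
  "cube_homotopic X x0 \<equiv> homotopic_with (\<lambda>k. \<forall>p \<in> cube_bd. k p = x0) (top_of_set cube) X"

lemma cube_bd_subset: "cube_bd \<subseteq> cube"
  by (auto simp: cube_bd_def)

text \<open>Functions are total, so the rules for \<open>homotopic_with\<close> ask that the side
  condition depend only on values on the cube; it does, because the boundary lies in the
  cube.\<close>

lemma rel_cube_bd_cong:
  assumes "\<And>x. x \<in> topspace (top_of_set cube) \<Longrightarrow> h x = k x"
  shows "(\<forall>p\<in>cube_bd. h p = x0) \<longleftrightarrow> (\<forall>p\<in>cube_bd. k p = x0)"
  using assms cube_bd_subset by (metis subset_iff topspace_euclidean_subtopology)

lemma cube_homotopicI:
  fixes H :: "real \<times> real \<times> real \<times> real \<Rightarrow> 'a"
  assumes "continuous_map (top_of_set ({0..1} \<times> cube)) X H"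
    and "\<And>p. p \<in> cube \<Longrightarrow> H (0, p) = f p" "\<And>p. p \<in> cube \<Longrightarrow> H (1, p) = g p"
    and "\<And>\<tau> p. \<tau> \<in> {0..1} \<Longrightarrow> p \<in> cube_bd \<Longrightarrow> H (\<tau>, p) = x0"
  shows "cube_homotopic X x0 f g"
proof (subst homotopic_with)
  show "(\<forall>p\<in>cube_bd. h p = x0) \<longleftrightarrow> (\<forall>p\<in>cube_bd. k p = x0)"
    if "\<And>x. x \<in> topspace (top_of_set cube) \<Longrightarrow> h x = k x" for h k
    by (rule rel_cube_bd_cong) (use that in auto)
qed (intro exI[of _ H]; use assms in \<open>simp add: prod_topology_subtopology_eu\<close>)

lemma cube_homotopic_cong:
  assumes "cube_homotopic X x0 f g"
    and "\<And>p. p \<in> cube \<Longrightarrow> f' p = f p" "\<And>p. p \<in> cube \<Longrightarrow> g' p = g p"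
  shows "cube_homotopic X x0 f' g'"
  by (rule homotopic_with_eq[OF assms(1)]) (use assms in \<open>auto intro!: rel_cube_bd_cong\<close>)

lemma cube_homotopicE:
  assumes "cube_homotopic X x0 f g"
  obtains H :: "real \<times> real \<times> real \<times> real \<Rightarrow> 'a" where "continuous_map (top_of_set ({0..1} \<times> cube)) X H"
    "\<forall>p. H (0, p) = f p" "\<forall>p. H (1, p) = g p" "\<forall>\<tau>\<in>{0..1}. \<forall>p\<in>cube_bd. H (\<tau>, p) = x0"
  using assms unfolding homotopic_with_def prod_topology_subtopology_eu
  by (elim exE conjE) (rule that)

lemma cube_homotopic_refl: "f \<in> spheroids X x0 \<Longrightarrow> cube_homotopic X x0 f f"
  by (simp add: spheroids_def)

lemma cube_homotopic_imp_spheroids: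
  "cube_homotopic X x0 f g \<Longrightarrow> f \<in> spheroids X x0 \<and> g \<in> spheroids X x0"
  using homotopic_with_imp_continuous_maps[of _ "top_of_set cube" X f g]
    homotopic_with_imp_property[of _ "top_of_set cube" X f g]
  by (simp add: spheroids_def)

lemma cube_class_eqI:
  assumes "cube_homotopic X x0 f g"
  shows "cube_class X x0 f = cube_class X x0 g"
  unfolding cube_class_def
  by (intro Collect_cong iffI)
    (erule homotopic_with_trans[OF homotopic_with_symD[OF assms]], erule homotopic_with_trans[OF assms])

text \<open>The two homotopies are concatenated at each time. They match at the middle face because
  both keep the boundary at \<open>x0\<close>.\<close>

lemma cube_concat_homotopic:
  assumes "cube_homotopic X x0 f f'" "cube_homotopic X x0 g g'"
  shows "cube_homotopic X x0 (cube_concat f g) (cube_concat f' g')"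
proof -
  obtain F :: "real \<times> real \<times> real \<times> real \<Rightarrow> 'a" where F: "continuous_map (top_of_set ({0..1} \<times> cube)) X F"
    "\<forall>p. F (0, p) = f p" "\<forall>p. F (1, p) = f' p" "\<forall>\<tau>\<in>{0..1}. \<forall>p\<in>cube_bd. F (\<tau>, p) = x0"
    by (rule cube_homotopicE[OF assms(1)])
  obtain G :: "real \<times> real \<times> real \<times> real \<Rightarrow> 'a" where G: "continuous_map (top_of_set ({0..1} \<times> cube)) X G"
    "\<forall>p. G (0, p) = g p" "\<forall>p. G (1, p) = g' p" "\<forall>\<tau>\<in>{0..1}. \<forall>p\<in>cube_bd. G (\<tau>, p) = x0"
    by (rule cube_homotopicE[OF assms(2)])
  let ?l = "\<lambda>(\<tau>::real, s::real, tu::real \<times> real). (\<tau>, 2 * s, tu)"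
  let ?r = "\<lambda>(\<tau>::real, s::real, tu::real \<times> real). (\<tau>, 2 * s - 1, tu)"
  let ?p = "\<lambda>(\<tau>::real, s::real, tu::real \<times> real). s"
  let ?H = "\<lambda>x. if ?p x \<le> 1/2 then (F \<circ> ?l) x else (G \<circ> ?r) x"
  have bd: "(0, tu) \<in> cube_bd" "(1, tu) \<in> cube_bd" if "(s, tu) \<in> cube" for s tu
    using that by (auto simp: cube_bd_def cube_def)
  have "continuous_map (top_of_set ({0..1} \<times> cube)) X ?H"
  proof (rule continuous_map_cases_le)
    show "continuous_map (top_of_set ({0..1} \<times> cube)) euclideanreal ?p"
      by (auto simp: case_prod_unfold intro!: continuous_intros)
    show "continuous_map (subtopology (top_of_set ({0..1} \<times> cube))
        {x \<in> topspace (top_of_set ({0..1} \<times> cube)). ?p x \<le> 1/2}) X (F \<circ> ?l)"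
      by (rule continuous_map_compose[OF _ F(1)])
        (auto simp: subtopology_subtopology case_prod_unfold cube_def intro!: continuous_intros)
    show "continuous_map (subtopology (top_of_set ({0..1} \<times> cube))
        {x \<in> topspace (top_of_set ({0..1} \<times> cube)). 1/2 \<le> ?p x}) X (G \<circ> ?r)"
      by (rule continuous_map_compose[OF _ G(1)])
        (auto simp: subtopology_subtopology case_prod_unfold cube_def intro!: continuous_intros)
    show "(F \<circ> ?l) x = (G \<circ> ?r) x"
      if "x \<in> topspace (top_of_set ({0..1} \<times> cube))" "?p x = 1/2" for x
    proof -
      obtain \<tau> s tu where x: "x = (\<tau>, s, tu)" by (cases x)
      with that have "2 * s = 1" "\<tau> \<in> {0..1}" "(0, tu) \<in> cube_bd" "(1, tu) \<in> cube_bd"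
        using bd[of s tu] by simp_all
      then show ?thesis
        using F(4) G(4) by (simp add: x)
    qed
  qed auto
  then show ?thesis
  proof (rule cube_homotopicI)
    show "?H (\<tau>, p) = x0" if "\<tau> \<in> {0..1}" "p \<in> cube_bd" for \<tau> p
    proof -
      obtain s t u where p: "p = (s, t, u)" by (cases p)
      have "(2 * s, t, u) \<in> cube_bd" if "s \<le> 1/2"
        using \<open>p \<in> cube_bd\<close> that by (auto simp: p cube_bd_def cube_def)
      moreover have "(2 * s - 1, t, u) \<in> cube_bd" if "\<not> s \<le> 1/2"
        using \<open>p \<in> cube_bd\<close> that by (auto simp: p cube_bd_def cube_def)
      ultimately show ?thesis
        using F(4) G(4) that(1) by (simp add: p)
    qed
  qed (auto simp: cube_concat_def F G)
qed

text \<open>Continuity across the middle face is inherited from the previous lemma, applied to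
  constant homotopies.\<close>

lemma cube_concat_spheroids:
  assumes "f \<in> spheroids X x0" "g \<in> spheroids X x0"
  shows "cube_concat f g \<in> spheroids X x0"
  using cube_homotopic_imp_spheroids[OF cube_concat_homotopic[OF assms[THEN cube_homotopic_refl]]]
  by simp

section \<open>Reparametrization of the first coordinate and the monoid laws\<close>

lemma cube_homotopic_reparametrization:
  assumes f: "f \<in> spheroids X x0"
    and \<sigma>: "continuous_on {0..1} \<sigma>" "\<sigma> ` {0..1} \<subseteq> {0..1::real}" "\<sigma> 0 = 0" "\<sigma> 1 = 1"
  shows "cube_homotopic X x0 (\<lambda>(s, tu). f (\<sigma> s, tu)) f"
proof -
  \<comment> \<open>Straight-line homotopy from \<open>\<sigma>\<close> to the identity: convexity
    keeps it in the unit interval, and it fixes both ends.\<close>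
  let ?m = "\<lambda>(\<tau>::real, s::real, tu::real \<times> real). ((1 - \<tau>) * \<sigma> s + \<tau> * s, tu)"
  have convex: "(1 - \<tau>) * \<sigma> s + \<tau> * s \<in> {0..1}" if "\<tau> \<in> {0..1}" "s \<in> {0..1}" for \<tau> s
  proof -
    have "\<sigma> s \<in> {0..1}"
      using \<sigma>(2) that(2) by blast
    then show ?thesis
      using that convex_bound_le[of "\<sigma> s" 1 s "1 - \<tau>" \<tau>] by auto
  qed
  have "continuous_on ({0..1} \<times> cube) ?m"
    unfolding case_prod_unfold
    by (intro continuous_intros continuous_on_compose2[OF \<sigma>(1)]) (auto simp: cube_def)
  moreover have "?m \<in> {0..1} \<times> cube \<rightarrow> cube"
    using convex by (auto simp: cube_def)
  ultimately have m: "continuous_map (top_of_set ({0..1} \<times> cube)) (top_of_set cube) ?m"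
    by simp
  have bd: "?m (\<tau>, p) \<in> cube_bd" if "\<tau> \<in> {0..1}" "p \<in> cube_bd" for \<tau> p
    using that convex[of \<tau> "fst p"] by (auto simp: cube_bd_def cube_def \<sigma>)
  have "continuous_map (top_of_set ({0..1} \<times> cube)) X (f \<circ> ?m)"
    using f by (auto simp: spheroids_def intro: continuous_map_compose[OF m])
  then show ?thesis
    by (rule cube_homotopicI) (use f bd in \<open>auto simp: spheroids_def\<close>)
qed

lemma cube_homotopic_of_reparametrization:
  assumes f: "f \<in> spheroids X x0"
    and \<sigma>: "continuous_on {0..1} \<sigma>" "\<sigma> ` {0..1} \<subseteq> {0..1::real}" "\<sigma> 0 = 0" "\<sigma> 1 = 1"
    and g: "\<And>s tu. (s, tu) \<in> cube \<Longrightarrow> g (s, tu) = f (\<sigma> s, tu)"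
  shows "cube_homotopic X x0 g f"
  by (rule cube_homotopic_cong[OF cube_homotopic_reparametrization[OF f \<sigma>]]) (auto simp: g)

lemma spheroids_bd:
  assumes "f \<in> spheroids X x0" "(s, tu) \<in> cube"
  shows "f (0, tu) = x0" "f (1, tu) = x0"
  using assms by (auto simp: spheroids_def cube_bd_def cube_def)

lemma spheroids_const: "x0 \<in> topspace X \<Longrightarrow> (\<lambda>_. x0) \<in> spheroids X x0"
  by (simp add: spheroids_def)

text \<open>The concatenation is \<open>f\<close> run at double speed and then held at its end face,
  where it equals \<open>x0\<close>.\<close>

lemma cube_concat_const_right:
  assumes f: "f \<in> spheroids X x0"
  shows "cube_homotopic X x0 (cube_concat f (\<lambda>_. x0)) f"
proof (rule cube_homotopic_of_reparametrization[OF f])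
  show "continuous_on {0..1} (\<lambda>s::real. min 1 (2 * s))"
    by (intro continuous_intros)
  show "cube_concat f (\<lambda>_. x0) (s, tu) = f (min 1 (2 * s), tu)" if "(s, tu) \<in> cube" for s tu
    by (cases "s \<le> 1/2") (auto simp: cube_concat_def spheroids_bd[OF f that] split: prod.splits)
qed auto

lemma cube_concat_const_left:
  assumes f: "f \<in> spheroids X x0"
  shows "cube_homotopic X x0 (cube_concat (\<lambda>_. x0) f) f"
proof (rule cube_homotopic_of_reparametrization[OF f])
  show "continuous_on {0..1} (\<lambda>s::real. max 0 (2 * s - 1))"
    by (intro continuous_intros)
  show "cube_concat (\<lambda>_. x0) f (s, tu) = f (max 0 (2 * s - 1), tu)" if "(s, tu) \<in> cube" for s tu
    by (cases "s \<le> 1/2") (auto simp: cube_concat_def spheroids_bd[OF f that] split: prod.splits)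
qed auto

lemma cube_concat_assoc:
  assumes "f \<in> spheroids X x0" "g \<in> spheroids X x0" "k \<in> spheroids X x0"
  shows "cube_homotopic X x0 (cube_concat f (cube_concat g k)) (cube_concat (cube_concat f g) k)"
proof -
  \<comment> \<open>Piecewise linear with slopes 1/2, 1, 2 and breaks at 1/2 and 3/4: it carries the
    time intervals of \<open>f\<close>, \<open>g\<close>, \<open>k\<close> in one bracketing to
    those in the other. Writing it with \<open>min\<close> and \<open>max\<close> makes continuity
    immediate.\<close>
  define \<sigma> where "\<sigma> s = max (min (s/2) (1/4)) (s - 1/4) + max 0 (s - 3/4)" for s :: real
  have \<sigma>: "s \<le> 1/2 \<Longrightarrow> \<sigma> s = s / 2" "\<not> s \<le> 1/2 \<Longrightarrow> s \<le> 3/4 \<Longrightarrow> \<sigma> s = s - 1/4"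
    "\<not> s \<le> 3/4 \<Longrightarrow> \<sigma> s = 2 * s - 1" for s
    by (auto simp: \<sigma>_def)
  show ?thesis
  proof (rule cube_homotopic_of_reparametrization[where \<sigma> = \<sigma>])
    show "cube_concat (cube_concat f g) k \<in> spheroids X x0"
      using assms by (simp add: cube_concat_spheroids)
    show "continuous_on {0..1} \<sigma>"
      unfolding \<sigma>_def by (intro continuous_intros) auto
    show "\<sigma> ` {0..1} \<subseteq> {0..1}"
      by (auto simp: \<sigma>_def)
    show "cube_concat f (cube_concat g k) (s, tu) = cube_concat (cube_concat f g) k (\<sigma> s, tu)"
      if "(s, tu) \<in> cube" for s tu
    proof -
      obtain t u where tu: "tu = (t, u)" by (cases tu)
      consider "s \<le> 1/2" | "\<not> s \<le> 1/2" "s \<le> 3/4" | "\<not> s \<le> 1/2" "\<not> s \<le> 3/4"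
        by linarith
      then show ?thesis
      proof cases
        case 1
        then show ?thesis by (simp add: cube_concat_def tu \<sigma>(1))
      next
        case 2
        then show ?thesis by (simp add: cube_concat_def tu \<sigma>(2) right_diff_distrib)
      next
        case 3
        then show ?thesis by (simp add: cube_concat_def tu \<sigma>(3))
      qed
    qed
  qed (simp_all add: \<sigma>)
qed

lemma mult_cube_class:
  assumes "f \<in> spheroids X x0" "g \<in> spheroids X x0"
  shows "cube_class X x0 f \<otimes>\<^bsub>pi3 X x0\<^esub> cube_class X x0 g = cube_class X x0 (cube_concat f g)"
proof -
  let ?A = "cube_class X x0 f" and ?B = "cube_class X x0 g"
  have eq: "cube_class X x0 (cube_concat f' g') = cube_class X x0 (cube_concat f g)"
    if "f' \<in> ?A" "g' \<in> ?B" for f' g'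
    by (rule cube_class_eqI[OF homotopic_with_symD], rule cube_concat_homotopic)
      (use that in \<open>simp_all add: cube_class_def\<close>)
  \<comment> \<open>Both index sets are nonempty, so the union of equal classes is that class and
    not the empty set.\<close>
  have "f \<in> ?A" "g \<in> ?B"
    using assms by (simp_all add: cube_class_def spheroids_def)
  moreover have "?A \<otimes>\<^bsub>pi3 X x0\<^esub> ?B = (\<Union>f'\<in>?A. \<Union>g'\<in>?B. cube_class X x0 (cube_concat f g))"
    unfolding pi3_def monoid.select_convs by (intro SUP_cong refl eq)
  ultimately show ?thesis
    by auto
qed

lemma carrier_pi3: "carrier (pi3 X x0) = cube_class X x0 ` spheroids X x0"
  and one_pi3: "\<one>\<^bsub>pi3 X x0\<^esub> = cube_class X x0 (\<lambda>_. x0)"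
  by (simp_all add: pi3_def)

text \<open>Inverse classes are found later by exhibiting a two-sided inverse, which is unique in a
  monoid.\<close>

lemma monoid_pi3:
  assumes "x0 \<in> topspace X"
  shows "Group.monoid (pi3 X x0)"
proof
  note const = spheroids_const[OF assms]
  show "\<one>\<^bsub>pi3 X x0\<^esub> \<in> carrier (pi3 X x0)"
    using const by (simp add: carrier_pi3 one_pi3)
  fix a assume "a \<in> carrier (pi3 X x0)"
  then obtain f where f: "f \<in> spheroids X x0" "a = cube_class X x0 f"
    by (auto simp: carrier_pi3)
  show "\<one>\<^bsub>pi3 X x0\<^esub> \<otimes>\<^bsub>pi3 X x0\<^esub> a = a"
    using const f by (simp add: one_pi3 mult_cube_class cube_class_eqI[OF cube_concat_const_left])
  show "a \<otimes>\<^bsub>pi3 X x0\<^esub> \<one>\<^bsub>pi3 X x0\<^esub> = a"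
    using const f by (simp add: one_pi3 mult_cube_class cube_class_eqI[OF cube_concat_const_right])
  fix b assume "b \<in> carrier (pi3 X x0)"
  then obtain g where g: "g \<in> spheroids X x0" "b = cube_class X x0 g"
    by (auto simp: carrier_pi3)
  show "a \<otimes>\<^bsub>pi3 X x0\<^esub> b \<in> carrier (pi3 X x0)"
    using f g by (simp add: carrier_pi3 mult_cube_class cube_concat_spheroids)
  fix c assume "c \<in> carrier (pi3 X x0)"
  then obtain k where k: "k \<in> spheroids X x0" "c = cube_class X x0 k"
    by (auto simp: carrier_pi3)
  show "a \<otimes>\<^bsub>pi3 X x0\<^esub> b \<otimes>\<^bsub>pi3 X x0\<^esub> c = a \<otimes>\<^bsub>pi3 X x0\<^esub> (b \<otimes>\<^bsub>pi3 X x0\<^esub> c)"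
    using f g k cube_class_eqI[OF cube_concat_assoc[OF f(1) g(1) k(1)]]
    by (simp add: mult_cube_class cube_concat_spheroids)
qed

subsection \<open>Unit quaternions\<close>

text \<open>The pair \<open>(z1, z2)\<close> stands for the quaternion \<open>z1 + z2 j\<close>.\<close>

definition qmul :: "complex \<times> complex \<Rightarrow> complex \<times> complex \<Rightarrow> complex \<times> complex" where
  "qmul p q = (fst p * fst q - snd p * cnj (snd q), fst p * snd q + snd p * cnj (fst q))"

text \<open>On \<open>S3\<close> this is the inverse for \<open>qmul\<close>.\<close>

definition qcnj :: "complex \<times> complex \<Rightarrow> complex \<times> complex" where
  "qcnj p = (cnj (fst p), - snd p)"

primrec qpow :: "complex \<times> complex \<Rightarrow> nat \<Rightarrow> complex \<times> complex" where
  "qpow q 0 = (1, 0)"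
| "qpow q (Suc k) = qmul (qpow q k) q"

lemma S3_iff: "p \<in> S3 \<longleftrightarrow> (cmod (fst p))\<^sup>2 + (cmod (snd p))\<^sup>2 = 1"
  by (auto simp: S3_def)

lemma qmul_one_left [simp]: "qmul (1, 0) p = p"
  and qmul_one_right [simp]: "qmul p (1, 0) = p"
  by (simp_all add: qmul_def)

lemma qmul_assoc: "qmul (qmul p q) r = qmul p (qmul q r)"
  by (simp add: qmul_def algebra_simps)

lemma qmul_in_S3 [simp]:
  assumes "p \<in> S3" "q \<in> S3"
  shows "qmul p q \<in> S3"
proof -
  \<comment> \<open>Euler's four-square identity: the quaternion norm is multiplicative.\<close>
  have "(cmod (fst (qmul p q)))\<^sup>2 + (cmod (snd (qmul p q)))\<^sup>2 =
      ((cmod (fst p))\<^sup>2 + (cmod (snd p))\<^sup>2) * ((cmod (fst q))\<^sup>2 + (cmod (snd q))\<^sup>2)"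
    unfolding qmul_def cmod_power2 by (simp add: power2_eq_square algebra_simps)
  then show ?thesis
    using assms by (simp add: S3_iff)
qed

lemma qcnj_in_S3 [simp]: "p \<in> S3 \<Longrightarrow> qcnj p \<in> S3"
  by (simp add: S3_iff qcnj_def)

lemma one_in_S3 [simp]: "(1, 0) \<in> S3"
  by (simp add: S3_iff)

lemma qpow_in_S3 [simp]: "p \<in> S3 \<Longrightarrow> qpow p k \<in> S3"
  by (induction k) auto

lemma norm_square_S3: "p \<in> S3 \<Longrightarrow> fst p * cnj (fst p) + snd p * cnj (snd p) = 1"
  by (simp add: S3_iff complex_norm_square[symmetric] flip: of_real_add of_real_power)

lemma qmul_qcnj_right: "p \<in> S3 \<Longrightarrow> qmul p (qcnj p) = (1, 0)"
  and qmul_qcnj_left: "p \<in> S3 \<Longrightarrow> qmul (qcnj p) p = (1, 0)"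
  using norm_square_S3[of p] by (simp_all add: qmul_def qcnj_def algebra_simps)

lemma continuous_on_qmul [continuous_intros]:
  "continuous_on S f \<Longrightarrow> continuous_on S g \<Longrightarrow> continuous_on S (\<lambda>x. qmul (f x) (g x))"
  unfolding qmul_def by (intro continuous_intros)

lemma continuous_on_qcnj [continuous_intros]:
  "continuous_on S f \<Longrightarrow> continuous_on S (\<lambda>x. qcnj (f x))"
  unfolding qcnj_def by (intro continuous_intros)

lemma continuous_on_qpow [continuous_intros]:
  "continuous_on S f \<Longrightarrow> continuous_on S (\<lambda>x. qpow (f x) k)"
  by (induction k) (auto intro!: continuous_intros)

text \<open>Stretch \<open>f\<close> into the first and \<open>g\<close> into the second half of the cube, filling with the unit.\<close>

lemma cube_homotopic_qmul_concat:
  assumes f: "f \<in> spheroids (top_of_set S3) (1, 0)" and g: "g \<in> spheroids (top_of_set S3) (1, 0)"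
  shows "cube_homotopic (top_of_set S3) (1, 0) (\<lambda>p. qmul (f p) (g p)) (cube_concat f g)"
proof (rule cube_homotopicI)
  \<comment> \<open>At time \<open>\<tau>\<close>, \<open>f\<close> runs over
    [0, 1/(1+\<open>\<tau>\<close>)] and \<open>g\<close> over
    [\<open>\<tau>\<close>/(1+\<open>\<tau>\<close>), 1]. Both fill the cube at time 0 and occupy
    separate halves at time 1; clamping holds each at an end face outside its interval.\<close>
  let ?a = "\<lambda>(\<tau>::real, s::real, tu::real \<times> real). (min 1 ((1 + \<tau>) * s), tu)"
  let ?b = "\<lambda>(\<tau>::real, s::real, tu::real \<times> real). (max 0 ((1 + \<tau>) * s - \<tau>), tu)"
  let ?H = "\<lambda>x. qmul (f (?a x)) (g (?b x))"
  have le: "(1 + \<tau>) * s - \<tau> \<le> 1" if "\<tau> \<in> {0..1}" "s \<in> {0..1}" for \<tau> s :: real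
  proof -
    have "(1 + \<tau>) * s \<le> (1 + \<tau>) * 1"
      using that by (intro mult_left_mono) auto
    then show ?thesis by simp
  qed
  have a: "?a x \<in> cube" and b: "?b x \<in> cube" if "x \<in> {0..1} \<times> cube" for x
    using that le[of "fst x" "fst (snd x)"] by (auto simp: cube_def)
  have "continuous_on ({0..1} \<times> cube) ?a" "continuous_on ({0..1} \<times> cube) ?b"
    by (auto simp: case_prod_unfold intro!: continuous_intros)
  moreover have "continuous_on cube f" "f \<in> cube \<rightarrow> S3" "continuous_on cube g" "g \<in> cube \<rightarrow> S3"
    using f g by (simp_all add: spheroids_def)
  ultimately have "continuous_on ({0..1} \<times> cube) ?H"
    using a b by (intro continuous_intros) (auto elim!: continuous_on_compose2)
  moreover have "?H \<in> {0..1} \<times> cube \<rightarrow> S3"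
    using a b \<open>f \<in> cube \<rightarrow> S3\<close> \<open>g \<in> cube \<rightarrow> S3\<close> by (blast intro: qmul_in_S3)
  ultimately show "continuous_map (top_of_set ({0..1} \<times> cube)) (top_of_set S3) ?H"
    by simp
  show "?H (0, p) = qmul (f p) (g p)" if "p \<in> cube" for p
    using that by (auto simp: cube_def)
  show "?H (1, p) = cube_concat f g p" if "p \<in> cube" for p
  proof -
    obtain s t u where p: "p = (s, t, u)" by (cases p)
    then have "f (1, t, u) = (1, 0)" "g (0, t, u) = (1, 0)"
      using that spheroids_bd[OF f] spheroids_bd[OF g] by blast+
    then show ?thesis
      by (cases "s \<le> 1/2") (simp_all add: p cube_concat_def)
  qed
  show "?H (\<tau>, p) = (1, 0)" if "\<tau> \<in> {0..1}" "p \<in> cube_bd" for \<tau> p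
  proof -
    have "?a (\<tau>, p) \<in> cube_bd" "?b (\<tau>, p) \<in> cube_bd"
      using that le[of \<tau> "fst p"] by (auto simp: cube_bd_def cube_def)
    then show ?thesis
      using f g by (auto simp: spheroids_def)
  qed
qed

section \<open>Powers of classes that factor through \<open>S3\<close>\<close>

lemma compose_spheroids:
  "f \<in> spheroids X x0 \<Longrightarrow> continuous_map X Y h \<Longrightarrow> h \<circ> f \<in> spheroids Y (h x0)"
  using continuous_map_compose[of "top_of_set cube" X f Y h] by (simp add: spheroids_def)

text \<open>The map \<open>h\<close> carries the homotopy between pointwise product and
  concatenation to its target, so the group operation can be computed with quaternions.\<close>

lemma mult_cube_class_qmul:
  assumes f: "f \<in> spheroids (top_of_set S3) (1, 0)" and g: "g \<in> spheroids (top_of_set S3) (1, 0)"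
    and h: "continuous_map (top_of_set S3) X h" and x0: "x0 = h (1, 0)"
  shows "cube_class X x0 (h \<circ> f) \<otimes>\<^bsub>pi3 X x0\<^esub> cube_class X x0 (h \<circ> g) =
    cube_class X x0 (h \<circ> (\<lambda>p. qmul (f p) (g p)))"
proof -
  have "cube_homotopic X x0 (h \<circ> (\<lambda>p. qmul (f p) (g p))) (h \<circ> cube_concat f g)"
    by (rule homotopic_with_compose_continuous_map_left[OF cube_homotopic_qmul_concat[OF f g] h])
      (simp add: x0)
  moreover have "h \<circ> cube_concat f g = cube_concat (h \<circ> f) (h \<circ> g)"
    by (auto simp: cube_concat_def)
  ultimately show ?thesis
    using mult_cube_class[OF compose_spheroids[OF f h] compose_spheroids[OF g h]]
    by (simp add: x0 cube_class_eqI)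
qed

lemma cube_to_S3_spheroid: "cube_to_S3 \<in> spheroids (top_of_set S3) (1, 0)"
proof -
  define v1 v2 v3 :: "real \<times> real \<times> real \<Rightarrow> real" where
    "v1 p = 2 * fst p - 1" and "v2 p = 2 * fst (snd p) - 1" and "v3 p = 2 * snd (snd p) - 1" for p
  define b where "b p = (1 - (v1 p)\<^sup>2) * (1 - (v2 p)\<^sup>2) * (1 - (v3 p)\<^sup>2)" for p
  define r where "r p = (v1 p)\<^sup>2 + (v2 p)\<^sup>2 + (v3 p)\<^sup>2" for p
  define d where "d p = r p + (b p)\<^sup>2" for p
  have c: "cube_to_S3 p = (Complex ((r p - (b p)\<^sup>2) / d p) (2 * b p * v1 p / d p),
      Complex (2 * b p * v2 p / d p) (2 * b p * v3 p / d p))" for p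
    by (simp add: cube_to_S3_def Let_def d_def r_def b_def v1_def v2_def v3_def split: prod.splits)
  \<comment> \<open>A zero of \<open>d\<close> would be the centre of the cube, but there
    \<open>b\<close> is 1.\<close>
  have d: "d p \<noteq> 0" for p
  proof
    assume "d p = 0"
    then have "b p = 0" "v1 p = 0" "v2 p = 0" "v3 p = 0"
      by (auto simp: d_def r_def add_nonneg_eq_0_iff)
    then show False
      by (simp add: b_def)
  qed
  have "cube_to_S3 p \<in> S3" for p
  proof -
    \<comment> \<open>The identity behind stereographic projection: (r - b^2)^2 + 4 b^2 r = (r +
      b^2)^2.\<close>
    have "(r p - (b p)\<^sup>2)\<^sup>2 + (2 * b p * v1 p)\<^sup>2 + ((2 * b p * v2 p)\<^sup>2 + (2 * b p * v3 p)\<^sup>2) = (d p)\<^sup>2"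
      by (simp add: d_def r_def power2_eq_square algebra_simps)
    then show ?thesis
      using d[of p] by (simp add: S3_iff c cmod_power2 power_divide flip: add_divide_distrib)
  qed
  moreover have "continuous_on cube cube_to_S3"
    unfolding c Complex_eq d_def r_def b_def v1_def v2_def v3_def
    using d by (intro continuous_intros) (auto simp: d_def r_def b_def v1_def v2_def v3_def)
  moreover have "cube_to_S3 p = (1, 0)" if "p \<in> cube_bd" for p
  proof -
    have "b p = 0"
      using that by (auto simp: cube_bd_def b_def v1_def v2_def v3_def)
    then show ?thesis
      using d[of p] by (simp add: c d_def complex_eq_iff)
  qed
  ultimately show ?thesis
    by (simp add: spheroids_def)
qed

lemma qpow_one [simp]: "qpow (1, 0) k = (1, 0)"
  by (induction k) auto

lemma qpow_spheroids:
  assumes "f \<in> spheroids (top_of_set S3) (1, 0)"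
  shows "(\<lambda>p. qpow (f p) k) \<in> spheroids (top_of_set S3) (1, 0)"
proof -
  have "continuous_map (top_of_set S3) (top_of_set S3) (\<lambda>q. qpow q k)"
    by (auto intro!: continuous_intros)
  from compose_spheroids[OF assms this] show ?thesis
    by (simp add: o_def)
qed

lemma qcnj_spheroids:
  assumes "f \<in> spheroids (top_of_set S3) (1, 0)"
  shows "(\<lambda>p. qcnj (f p)) \<in> spheroids (top_of_set S3) (1, 0)"
proof -
  have "continuous_map (top_of_set S3) (top_of_set S3) qcnj"
    by (auto intro!: continuous_on_qcnj continuous_on_id)
  from compose_spheroids[OF assms this] show ?thesis
    by (simp add: o_def qcnj_def)
qed

lemma nat_pow_cube_class:
  assumes f: "f \<in> spheroids (top_of_set S3) (1, 0)"
    and h: "continuous_map (top_of_set S3) X h" and x0: "x0 = h (1, 0)"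
  shows "cube_class X x0 (h \<circ> f) [^]\<^bsub>pi3 X x0\<^esub> k = cube_class X x0 (h \<circ> (\<lambda>p. qpow (f p) k))"
proof (induction k)
  case 0
  show ?case
    by (simp add: nat_pow_def one_pi3 o_def x0)
next
  case (Suc k)
  show ?case
    using mult_cube_class_qmul[OF qpow_spheroids[OF f] f h x0, of k] Suc
    by (simp add: nat_pow_def o_def)
qed

text \<open>Products of classes are pointwise products, so the pointwise quaternion inverse gives
  the inverse class.\<close>

lemma inv_cube_class:
  assumes f: "f \<in> spheroids (top_of_set S3) (1, 0)"
    and h: "continuous_map (top_of_set S3) X h" and x0: "x0 = h (1, 0)"
  shows "inv\<^bsub>pi3 X x0\<^esub> (cube_class X x0 (h \<circ> f)) = cube_class X x0 (h \<circ> (\<lambda>p. qcnj (f p)))"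
proof -
  have "x0 \<in> topspace X"
    using h one_in_S3 by (auto simp: x0 continuous_map_def)
  then interpret Group.monoid "pi3 X x0"
    by (rule monoid_pi3)
  note g = qcnj_spheroids[OF f]
  have S3: "f p \<in> S3" if "p \<in> cube" for p
    using f that by (auto simp: spheroids_def)
  \<comment> \<open>Off the cube \<open>f\<close> is arbitrary, so the product with its conjugate is
    known to be \<open>(1, 0)\<close> only on the cube; the class does not see the
    difference.\<close>
  have const: "cube_class X x0 (h \<circ> k) = \<one>\<^bsub>pi3 X x0\<^esub>"
    if "\<And>p. p \<in> cube \<Longrightarrow> k p = (1, 0)" for k :: "real \<times> real \<times> real \<Rightarrow> complex \<times> complex"
    unfolding one_pi3
    by (rule cube_class_eqI, rule cube_homotopic_cong[OF cube_homotopic_refl[OF spheroids_const]])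
      (use \<open>x0 \<in> topspace X\<close> that in \<open>auto simp: x0\<close>)
  have "cube_class X x0 (h \<circ> f) \<otimes>\<^bsub>pi3 X x0\<^esub> cube_class X x0 (h \<circ> (\<lambda>p. qcnj (f p))) = \<one>\<^bsub>pi3 X x0\<^esub>"
    unfolding mult_cube_class_qmul[OF f g h x0] by (rule const) (simp add: qmul_qcnj_right S3)
  moreover have "cube_class X x0 (h \<circ> (\<lambda>p. qcnj (f p))) \<otimes>\<^bsub>pi3 X x0\<^esub> cube_class X x0 (h \<circ> f) = \<one>\<^bsub>pi3 X x0\<^esub>"
    unfolding mult_cube_class_qmul[OF g f h x0] by (rule const) (simp add: qmul_qcnj_left S3)
  moreover have "cube_class X x0 (h \<circ> k) \<in> carrier (pi3 X x0)"
    if "k \<in> spheroids (top_of_set S3) (1, 0)" for k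
    using compose_spheroids[OF that h] by (simp add: carrier_pi3 x0)
  ultimately show ?thesis
    using f g by (intro inv_unique'[symmetric]) auto
qed

text \<open>For \<open>f = cube_to_S3\<close> and the Hopf map \<open>h\<close>, this represents
  \<open>n[h]\<close> by \<open>h\<close> after the quaternionic power map.\<close>

lemma int_pow_cube_class:
  assumes f: "f \<in> spheroids (top_of_set S3) (1, 0)"
    and h: "continuous_map (top_of_set S3) X h" and x0: "x0 = h (1, 0)"
  shows "cube_class X x0 (h \<circ> f) [^]\<^bsub>pi3 X x0\<^esub> (n :: int) =
    cube_class X x0 (h \<circ> (\<lambda>p. if n < 0 then qcnj (qpow (f p) (nat (- n))) else qpow (f p) (nat n)))"
  using inv_cube_class[OF qpow_spheroids[OF f] h x0]
  by (simp add: int_pow_def2 nat_pow_cube_class[OF assms])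

subsection \<open>Twisted self-maps of the sphere\<close>

abbreviation S3_homotopic :: "(complex \<times> complex \<Rightarrow> complex \<times> complex) \<Rightarrow>
    (complex \<times> complex \<Rightarrow> complex \<times> complex) \<Rightarrow> bool" where
  "S3_homotopic \<equiv> homotopic_with_canon (\<lambda>_. True) S3 S3"

lemma homotopic_canonI:
  fixes H :: "real \<times> 'a::topological_space \<Rightarrow> 'b::topological_space"
  assumes "continuous_on ({0..1} \<times> S) H" "H \<in> {0..1} \<times> S \<rightarrow> T"
    and "\<And>x. x \<in> S \<Longrightarrow> H (0, x) = f x" "\<And>x. x \<in> S \<Longrightarrow> H (1, x) = g x"
  shows "homotopic_with_canon (\<lambda>_. True) S T f g"
  by (subst homotopic_with) (use assms in \<open>auto simp: prod_topology_subtopology_eu intro!: exI[of _ H]\<close>)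

lemma S3_homotopic_qmul:
  assumes "S3_homotopic f f'" "S3_homotopic g g'"
  shows "S3_homotopic (\<lambda>p. qmul (f p) (g p)) (\<lambda>p. qmul (f' p) (g' p))"
proof -
  obtain F :: "real \<times> complex \<times> complex \<Rightarrow> complex \<times> complex"
    where F: "continuous_on ({0..1} \<times> S3) F" "F \<in> {0..1} \<times> S3 \<rightarrow> S3"
      "\<forall>p. F (0, p) = f p" "\<forall>p. F (1, p) = f' p"
    using assms(1) by (auto simp: homotopic_with_def prod_topology_subtopology_eu)
  obtain G :: "real \<times> complex \<times> complex \<Rightarrow> complex \<times> complex"
    where G: "continuous_on ({0..1} \<times> S3) G" "G \<in> {0..1} \<times> S3 \<rightarrow> S3"
      "\<forall>p. G (0, p) = g p" "\<forall>p. G (1, p) = g' p"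
    using assms(2) by (auto simp: homotopic_with_def prod_topology_subtopology_eu)
  show ?thesis
    by (rule homotopic_canonI[where H = "\<lambda>x. qmul (F x) (G x)"])
      (use F G in \<open>auto intro!: continuous_intros qmul_in_S3\<close>)
qed

lemma S3_homotopic_qcnj:
  "S3_homotopic f g \<Longrightarrow> S3_homotopic (\<lambda>p. qcnj (f p)) (\<lambda>p. qcnj (g p))"
  by (drule homotopic_with_compose_continuous_map_left[where h = qcnj and q = "\<lambda>_. True"])
    (auto simp: o_def intro!: continuous_intros continuous_on_id)

text \<open>At \<open>snd p = 0\<close> the junk value \<open>sgn 0 = 0\<close> is harmless, being multiplied by \<open>0\<close>.\<close>

definition twist :: "(complex \<Rightarrow> complex) \<Rightarrow> complex \<times> complex \<Rightarrow> complex \<times> complex" where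
  "twist a p = (fst p, of_real (cmod (snd p)) * a (sgn (snd p)))"

lemma cmod_sgn: "z \<noteq> 0 \<Longrightarrow> cmod (sgn z) = 1"
  by (simp add: norm_sgn)

lemma cmod_mult_sgn: "of_real (cmod z) * sgn z = z"
  by (cases "z = 0") (simp_all add: sgn_eq)

lemma cmod_snd_twist:
  assumes "\<And>w. cmod w = 1 \<Longrightarrow> cmod (a w) = 1"
  shows "cmod (snd (twist a p)) = cmod (snd p)"
  using assms[OF cmod_sgn, of "snd p"] by (cases "snd p = 0") (auto simp: twist_def norm_mult)

lemma twist_in_S3:
  assumes "\<And>w. cmod w = 1 \<Longrightarrow> cmod (a w) = 1" "p \<in> S3"
  shows "twist a p \<in> S3"
  using assms(2) cmod_snd_twist[of a p, OF assms(1)]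
  by (simp add: S3_iff) (simp add: twist_def)

text \<open>Away from the origin this is a composition with \<open>sgn\<close>; at the origin the
  bound by \<open>cmod z\<close> squeezes the values to 0, jointly with the time parameter.\<close>

lemma continuous_on_radial:
  fixes A :: "real \<times> complex \<Rightarrow> complex"
  assumes A: "continuous_on ({0..1} \<times> sphere 0 1) A"
    and unit: "\<And>t w. t \<in> {0..1} \<Longrightarrow> cmod w = 1 \<Longrightarrow> cmod (A (t, w)) = 1"
  shows "continuous_on ({0..1} \<times> UNIV) (\<lambda>(t, z). of_real (cmod z) * A (t, sgn z))"
    (is "continuous_on ?S ?G")
  unfolding continuous_on_eq_continuous_within
proof
  fix x assume x: "x \<in> ?S"
  obtain t z where tz: "x = (t, z)" by (cases x)
  show "continuous (at x within ?S) ?G"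
  proof (cases "z = 0")
    case True
    have "(?G \<longlongrightarrow> 0) (at x within ?S)"
    proof (rule Lim_null_comparison)
      have "cmod (?G y) \<le> cmod (snd y)" if "y \<in> ?S" for y
        using that unit[OF _ cmod_sgn, of "fst y" "snd y"]
        by (cases "snd y = 0") (auto simp: norm_mult)
      then show "\<forall>\<^sub>F y in at x within ?S. cmod (?G y) \<le> cmod (snd y)"
        by (auto simp: eventually_at_filter)
      have "((\<lambda>y. cmod (snd y)) \<longlongrightarrow> cmod (snd x)) (at x within ?S)"
        by (intro tendsto_intros)
      then show "((\<lambda>y. cmod (snd y)) \<longlongrightarrow> 0) (at x within ?S)"
        using True by (simp add: tz)
    qed
    then show ?thesis
      using True by (simp add: continuous_within tz)
  next
    case False
    have "continuous_on ({0..1} \<times> (- {0})) ?G"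
      unfolding case_prod_unfold
      by (intro continuous_intros continuous_on_compose2[OF A])
        (auto simp: cmod_sgn sgn_div_norm intro!: continuous_intros)
    \<comment> \<open>Continuity is local, and \<open>z \<noteq> 0\<close> is an open
      condition.\<close>
    moreover have "at x within ?S = at x within {0..1} \<times> (- {0})"
      by (rule at_within_nhd[where S = "UNIV \<times> (- {0})"])
        (use False in \<open>auto simp: tz intro!: open_Times\<close>)
    ultimately show ?thesis
      using x False by (auto simp: continuous_on_eq_continuous_within tz)
  qed
qed

lemma S3_homotopic_twist:
  fixes A :: "real \<times> complex \<Rightarrow> complex"
  assumes A: "continuous_on ({0..1} \<times> sphere 0 1) A"
    and unit: "\<And>t w. t \<in> {0..1} \<Longrightarrow> cmod w = 1 \<Longrightarrow> cmod (A (t, w)) = 1"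
    and "\<And>w. cmod w = 1 \<Longrightarrow> A (0, w) = a w" "\<And>w. cmod w = 1 \<Longrightarrow> A (1, w) = b w"
  shows "S3_homotopic (twist a) (twist b)"
proof (rule homotopic_canonI)
  let ?H = "\<lambda>(t, p). twist (\<lambda>w. A (t, w)) p"
  have "continuous_on ({0..1} \<times> S3)
      (\<lambda>x. case (fst x, snd (snd x)) of (t, z) \<Rightarrow> of_real (cmod z) * A (t, sgn z))"
    by (rule continuous_on_compose2[OF continuous_on_radial[OF A unit]])
      (auto intro!: continuous_intros)
  then show "continuous_on ({0..1} \<times> S3) ?H"
    unfolding twist_def case_prod_unfold
    by (intro continuous_on_Pair) (auto intro!: continuous_intros)
  show "?H \<in> {0..1} \<times> S3 \<rightarrow> S3"
    using unit by (auto intro!: twist_in_S3)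
  \<comment> \<open>For \<open>snd p = 0\<close> the endpoint conditions on \<open>A\<close> say
    nothing about \<open>sgn 0\<close>, but all twists have second coordinate 0 there.\<close>
  show "?H (0, p) = twist a p" "?H (1, p) = twist b p" for p
    using assms(3,4)[OF cmod_sgn, of "snd p"] by (cases "snd p = 0"; simp add: twist_def)+
qed

text \<open>Where \<open>a\<close> or \<open>b\<close> is trivial, one of the two twists agrees with \<open>twist (\<lambda>_. 1)\<close> and cancels.\<close>

lemma qmul_twist:
  assumes p: "p \<in> S3" and ab: "\<And>w. cmod w = 1 \<Longrightarrow> a w = 1 \<or> b w = 1"
  shows "qmul (qmul (twist a p) (qcnj (twist (\<lambda>_. 1) p))) (twist b p) = twist (\<lambda>w. a w * b w) p"
proof -
  let ?E = "twist (\<lambda>_. 1) p"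
  have E: "?E \<in> S3"
    using p by (rule twist_in_S3[rotated]) simp
  \<comment> \<open>If \<open>snd p = 0\<close>, all these twists equal \<open>(fst p, 0)\<close>.
    Otherwise the loop with value 1 gives \<open>?E\<close>, and the product loop has the value of
    the other one.\<close>
  have "twist a p = ?E \<and> twist b p = twist (\<lambda>w. a w * b w) p \<or>
      twist b p = ?E \<and> twist a p = twist (\<lambda>w. a w * b w) p"
    using ab[OF cmod_sgn, of "snd p"] by (cases "snd p = 0") (auto simp: twist_def)
  then show ?thesis
  proof (elim disjE conjE)
    show ?thesis if "twist a p = ?E" "twist b p = twist (\<lambda>w. a w * b w) p"
      using that E by (simp add: qmul_qcnj_right)
    show ?thesis if "twist b p = ?E" "twist a p = twist (\<lambda>w. a w * b w) p"
      using that E by (simp add: qmul_qcnj_left qmul_assoc)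
  qed
qed

text \<open>The image of \<open>twist (\<lambda>_. 1)\<close> is a disc.\<close>

lemma S3_homotopic_twist_trivial: "S3_homotopic (twist (\<lambda>_. 1)) (\<lambda>_. (1, 0))"
proof (rule homotopic_canonI)
  \<comment> \<open>The first coordinate ranges over the unit disc, which is contracted linearly to
    1; the second is the nonnegative real that puts the point back on the sphere.\<close>
  let ?z = "\<lambda>(t::real, p::complex \<times> complex). of_real (1 - t) * fst p + of_real t"
  let ?H = "\<lambda>x. (?z x, complex_of_real (sqrt (1 - (cmod (?z x))\<^sup>2)))"
  show "continuous_on ({0..1} \<times> S3) ?H"
    unfolding case_prod_unfold by (intro continuous_intros)
  have "cmod (?z x) \<le> 1" if "x \<in> {0..1} \<times> S3" for x
  proof -
    obtain t p where x: "x = (t, p)" by (cases x)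
    with that have t: "0 \<le> t" "t \<le> 1" and p: "(cmod (fst p))\<^sup>2 + (cmod (snd p))\<^sup>2 = 1"
      by (auto simp: S3_iff)
    have "(cmod (fst p))\<^sup>2 \<le> 1\<^sup>2"
      using p zero_le_power2[of "cmod (snd p)"] unfolding power_one by linarith
    then have "cmod (fst p) \<le> 1"
      by (rule power2_le_imp_le) simp
    have "cmod (?z x) \<le> cmod (of_real (1 - t) * fst p) + cmod (of_real t)"
      unfolding x case_prod_conv by (rule norm_triangle_ineq)
    also have "\<dots> = (1 - t) * cmod (fst p) + t"
      using t by (simp add: norm_mult del: of_real_diff)
    also have "\<dots> \<le> (1 - t) * 1 + t"
      using t \<open>cmod (fst p) \<le> 1\<close> by (intro add_mono mult_left_mono) auto
    finally show ?thesis by simp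
  qed
  then show "?H \<in> {0..1} \<times> S3 \<rightarrow> S3"
    by (auto simp: S3_iff abs_square_le_1)
  show "?H (0, p) = twist (\<lambda>_. 1) p" if "p \<in> S3" for p
  proof -
    have "1 - (cmod (fst p))\<^sup>2 = (cmod (snd p))\<^sup>2"
      using that by (simp add: S3_iff)
    then show ?thesis
      by (simp add: twist_def)
  qed
qed simp

text \<open>On the unit circle, \<open>arccos (Re w)\<close> is the absolute value of the angle x of
  \<open>w\<close> in [-pi, pi], so \<open>rot k\<close> sends angle x to x + k|x|. Thus
  \<open>rot (-1)\<close> is 1 on the upper half circle and squares on the lower half,
  \<open>rot 1\<close> the reverse, and letting \<open>k\<close> go to 0 deforms both to the
  identity.\<close>

definition rot :: "real \<Rightarrow> complex \<Rightarrow> complex" where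
  "rot k w = w * cis (k * arccos (Re w))"

lemma cmod_rot: "cmod (rot k w) = cmod w"
  by (simp add: rot_def norm_mult)

lemma rot_0: "rot 0 w = w"
  by (simp add: rot_def)

text \<open>The point \<open>cis (arccos (Re w))\<close> of the upper half circle has the real part
  of \<open>w\<close>, so it is \<open>w\<close> or \<open>cnj w\<close>; dividing or multiplying
  \<open>w\<close> by it gives 1.\<close>

lemma rot_eq_1:
  assumes "cmod w = 1"
  shows "rot (-1) w = 1 \<or> rot 1 w = 1"
proof -
  have w: "(Re w)\<^sup>2 + (Im w)\<^sup>2 = 1"
    using assms by (simp flip: cmod_power2)
  have "\<bar>Re w\<bar> \<le> 1"
    using abs_Re_le_cmod[of w] assms by simp
  then have "-1 \<le> Re w" "Re w \<le> 1" by auto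
  moreover have "sqrt (1 - (Re w)\<^sup>2) = \<bar>Im w\<bar>"
    using w by (metis add_diff_cancel_left' real_sqrt_abs)
  ultimately have "cis (arccos (Re w)) = Complex (Re w) \<bar>Im w\<bar>"
    by (simp add: complex_eq_iff sin_arccos)
  then have "cis (arccos (Re w)) = (if 0 \<le> Im w then w else cnj w)"
    by (simp add: complex_eq_iff)
  moreover have "w * cnj w = 1"
    using assms by (simp flip: complex_norm_square)
  ultimately show ?thesis
    by (auto simp: rot_def cis_cnj[symmetric] split: if_splits)
qed

lemma continuous_on_rot [continuous_intros]:
  assumes "continuous_on S k" "continuous_on S f" "\<And>x. x \<in> S \<Longrightarrow> cmod (f x) = 1"
  shows "continuous_on S (\<lambda>x. rot (k x) (f x))"
proof -
  have "\<bar>Re (f x)\<bar> \<le> 1" if "x \<in> S" for x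
    using abs_Re_le_cmod[of "f x"] assms(3)[OF that] by simp
  then have "-1 \<le> Re (f x) \<and> Re (f x) \<le> 1" if "x \<in> S" for x
    using that by (simp add: abs_le_iff)
  then show ?thesis
    unfolding rot_def using assms(1,2) by (intro continuous_intros) auto
qed

section \<open>Twists by integer powers\<close>

abbreviation twist_power :: "int \<Rightarrow> complex \<times> complex \<Rightarrow> complex \<times> complex" where
  "twist_power n \<equiv> twist (\<lambda>w. w powi n)"

lemma cmod_powi: "cmod w = 1 \<Longrightarrow> cmod (w powi n) = 1"
  by (simp add: norm_power_int)

lemma twist_power_in_S3: "p \<in> S3 \<Longrightarrow> twist_power n p \<in> S3"
  by (rule twist_in_S3) (rule cmod_powi)

text \<open>Both rotation parameters grow from 0 together. Having two factors covers a single loop,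
  with the other exponent 0, as well as the product loop.\<close>

lemma S3_homotopic_twist_rot:
  "S3_homotopic (twist (\<lambda>w. w powi m * w powi n)) (twist (\<lambda>w. rot k w powi m * rot l w powi n))"
proof (rule S3_homotopic_twist)
  let ?A = "\<lambda>(t, w). rot (t * k) w powi m * rot (t * l) w powi n"
  \<comment> \<open>Powers with negative exponent are continuous only away from 0.\<close>
  have nz: "rot c w \<noteq> 0" if "cmod w = 1" for c w
    using that cmod_rot[of c w] by auto
  show "continuous_on ({0..1} \<times> sphere 0 1) ?A"
    unfolding case_prod_unfold using nz by (intro continuous_intros) auto
  show "cmod (?A (t, w)) = 1" if "cmod w = 1" for t w
    using that by (simp add: norm_mult cmod_powi cmod_rot)
qed (simp_all add: rot_0)

lemma S3_homotopic_twist_power_add: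
  "S3_homotopic (\<lambda>p. qmul (twist_power m p) (twist_power n p)) (twist_power (m + n))"
proof -
  let ?a = "\<lambda>w. rot (-1) w powi m" and ?b = "\<lambda>w. rot 1 w powi n"
  have ab: "?a w = 1 \<or> ?b w = 1" if "cmod w = 1" for w
    using rot_eq_1[OF that] by auto
  have a: "S3_homotopic (twist_power m) (twist ?a)"
    using S3_homotopic_twist_rot[of m 0 "-1" 0] by simp
  have b: "S3_homotopic (twist_power n) (twist ?b)"
    using S3_homotopic_twist_rot[of 0 n 0 1] by simp
  have one: "S3_homotopic (\<lambda>_. (1, 0)) (\<lambda>p. qcnj (twist (\<lambda>_. 1) p))"
    using S3_homotopic_qcnj[OF homotopic_with_symD[OF S3_homotopic_twist_trivial]]
    by (simp add: qcnj_def)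
  \<comment> \<open>A unit is inserted between the factors and deformed to the inverse of the
    trivial twist, so that the end map has the form treated by \<open>qmul_twist\<close>.\<close>
  have "S3_homotopic (\<lambda>p. qmul (qmul (twist_power m p) (1, 0)) (twist_power n p))
      (\<lambda>p. qmul (qmul (twist ?a p) (qcnj (twist (\<lambda>_. 1) p))) (twist ?b p))"
    by (intro S3_homotopic_qmul a b one)
  then have "S3_homotopic (\<lambda>p. qmul (twist_power m p) (twist_power n p)) (twist (\<lambda>w. ?a w * ?b w))"
    by (rule homotopic_with_eq) (use ab in \<open>auto intro!: qmul_twist[symmetric]\<close>)
  \<comment> \<open>Both rotations are undone at once inside the product loop.\<close>
  also have "S3_homotopic (twist (\<lambda>w. ?a w * ?b w)) (twist (\<lambda>w. w powi m * w powi n))"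
    by (rule homotopic_with_symD[OF S3_homotopic_twist_rot])
  finally (homotopic_with_trans) show ?thesis
  proof (rule homotopic_with_eq)
    \<comment> \<open>The law of exponents can fail for \<open>sgn 0 = 0\<close>, since
      \<open>0 powi 0 = 1\<close>; the factor \<open>cmod (snd p)\<close> vanishes there.\<close>
    show "twist_power (m + n) p = twist (\<lambda>w. w powi m * w powi n) p" for p
      by (cases "snd p = 0") (simp_all add: twist_def power_int_add sgn_zero_iff)
  qed simp_all
qed

text \<open>Each induction step adds exponent 1, whose twist is the identity; the start is the
  null-homotopy of the trivial twist.\<close>

lemma S3_homotopic_twist_power_nat: "S3_homotopic (twist_power (int k)) (\<lambda>p. qpow p k)"
proof (induction k)
  case 0
  then show ?case
    using S3_homotopic_twist_trivial by simp
next
  case (Suc k)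
  have id: "S3_homotopic (twist_power 1) (\<lambda>p. p)"
    by (rule homotopic_with_eq[where f = "\<lambda>p. p" and g = "\<lambda>p. p"])
      (auto simp: twist_def cmod_mult_sgn)
  have "S3_homotopic (twist_power (int k + 1)) (\<lambda>p. qmul (twist_power (int k) p) (twist_power 1 p))"
    by (rule homotopic_with_symD[OF S3_homotopic_twist_power_add])
  also have "S3_homotopic (\<lambda>p. qmul (twist_power (int k) p) (twist_power 1 p)) (\<lambda>p. qmul (qpow p k) p)"
    by (intro S3_homotopic_qmul Suc id)
  finally (homotopic_with_trans) show ?case
    by (simp add: add.commute)
qed

text \<open>By additivity the twists of exponents \<open>k\<close> and \<open>-k\<close> have a
  null-homotopic product; multiplying on the left by the conjugate of the first cancels it
  exactly.\<close>

lemma S3_homotopic_twist_power_neg: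
  "S3_homotopic (twist_power (- int k)) (\<lambda>p. qcnj (qpow p k))"
proof -
  let ?f = "\<lambda>p. qcnj (twist_power (int k) p)"
  have f: "S3_homotopic ?f (\<lambda>p. qcnj (qpow p k))"
    by (rule S3_homotopic_qcnj[OF S3_homotopic_twist_power_nat])
  have "S3_homotopic (\<lambda>p. qmul (twist_power (int k) p) (twist_power (- int k) p)) (\<lambda>_. (1, 0))"
    using homotopic_with_trans[OF S3_homotopic_twist_power_add[of "int k" "- int k"]]
      S3_homotopic_twist_trivial by simp
  then have "S3_homotopic (\<lambda>p. qmul (?f p) (qmul (twist_power (int k) p) (twist_power (- int k) p)))
      (\<lambda>p. qmul (qcnj (qpow p k)) (1, 0))"
    by (rule S3_homotopic_qmul[OF f])
  then show ?thesis
  proof (rule homotopic_with_eq)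
    show "twist_power (- int k) p = qmul (?f p) (qmul (twist_power (int k) p) (twist_power (- int k) p))"
      if "p \<in> topspace (top_of_set S3)" for p
      unfolding qmul_assoc[symmetric]
      using that qmul_qcnj_left[OF twist_power_in_S3[of p "int k"]] by simp
  qed simp_all
qed

subsection \<open>The Hopf fibration\<close>

lemma topspace_orbit_space: "topspace orbit_space = hopf_orbit ` S3"
proof
  show "topspace orbit_space \<subseteq> hopf_orbit ` S3"
    using openin_topspace[of orbit_space] by (simp only: openin_orbit_space)
  have "{z \<in> S3. hopf_orbit z \<in> hopf_orbit ` S3} = S3"
    by auto
  then have "openin orbit_space (hopf_orbit ` S3)"
    by (simp add: openin_orbit_space)
  then show "hopf_orbit ` S3 \<subseteq> topspace orbit_space"
    by (rule openin_subset)
qed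

lemma continuous_map_hopf_orbit: "continuous_map (top_of_set S3) orbit_space hopf_orbit"
  by (auto simp: continuous_map_def topspace_orbit_space openin_orbit_space)

lemma hopf_orbit_eq_base_iff:
  assumes "z \<in> S3"
  shows "hopf_orbit z = hopf_orbit (1, 0) \<longleftrightarrow> snd z = 0"
proof
  assume "hopf_orbit z = hopf_orbit (1, 0)"
  moreover have "z \<in> hopf_orbit z"
    by (auto simp: hopf_orbit_def intro!: exI[of _ 1])
  ultimately show "snd z = 0"
    by (auto simp: hopf_orbit_def)
next
  assume z: "snd z = 0"
  with assms have unit: "cmod (fst z) = 1"
    by (simp add: S3_iff abs_square_eq_1)
  have "(l * fst z, 0) \<in> hopf_orbit (1, 0)" if "cmod l = 1" for l
    using that unit by (auto simp: hopf_orbit_def norm_mult)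
  moreover have "(l, 0) \<in> hopf_orbit z" if "cmod l = 1" for l
    using that unit z
    by (auto simp: hopf_orbit_def norm_divide intro!: exI[of _ "l / fst z"])
  ultimately show "hopf_orbit z = hopf_orbit (1, 0)"
    using z by (auto simp: hopf_orbit_def[of z] hopf_orbit_def[of "(1, 0)"])
qed

theorem theorem4p1:
  fixes \<iota> :: "(complex \<times> complex) set \<Rightarrow> real ^ 3"
    and h :: "complex \<times> complex \<Rightarrow> real ^ 3"
    and y0 :: "real ^ 3"
    and n :: int
  assumes identification: "homeomorphic_map orbit_space (top_of_set S2) \<iota>"
    and h_def: "h = \<iota> \<circ> hopf_orbit"
    and y0_def: "y0 = h (1, 0)"
    and "n \<noteq> 0"
  shows "\<exists>\<phi>. continuous_map (top_of_set S3) (top_of_set S2) \<phi> \<and>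
    \<phi> \<in> free_class (top_of_set S2)
          (cube_class (top_of_set S2) y0 (h \<circ> cube_to_S3) [^]\<^bsub>pi3 (top_of_set S2) y0\<^esub> n) \<and>
    {z \<in> S3. \<phi> z = y0} = {(z1, 0) | z1. cmod z1 = 1}"
proof (intro exI conjI)
  let ?P = "\<lambda>q. if n < 0 then qcnj (qpow q (nat (- n))) else qpow q (nat n)"
  let ?A = "cube_class (top_of_set S2) y0 (h \<circ> cube_to_S3) [^]\<^bsub>pi3 (top_of_set S2) y0\<^esub> n"
  have h: "continuous_map (top_of_set S3) (top_of_set S2) h"
    unfolding h_def
    by (rule continuous_map_compose[OF continuous_map_hopf_orbit
          homeomorphic_imp_continuous_map[OF identification]])
  \<comment> \<open>The map \<open>h\<close> after \<open>?P\<close> represents the class, but its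
    fibre can be too large: already for \<open>n = 2\<close> the point \<open>(0, 1)\<close> goes to
    \<open>(-1, 0)\<close>. The twist replaces it.\<close>
  have "S3_homotopic (twist_power n) ?P"
    using S3_homotopic_twist_power_nat[of "nat n"] S3_homotopic_twist_power_neg[of "nat (- n)"]
    by (cases "n < 0") auto
  then have hom: "homotopic_with_canon (\<lambda>_. True) S3 S2 (h \<circ> twist_power n) (h \<circ> ?P)"
    by (rule homotopic_with_compose_continuous_map_left[OF _ h]) simp
  then show "continuous_map (top_of_set S3) (top_of_set S2) (h \<circ> twist_power n)"
    by (rule homotopic_with_imp_continuous_maps[THEN conjunct1])
  have "?A = cube_class (top_of_set S2) y0 ((h \<circ> ?P) \<circ> cube_to_S3)"
    unfolding int_pow_cube_class[OF cube_to_S3_spheroid h y0_def] by (simp add: o_def)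
  moreover have "(h \<circ> ?P) \<circ> cube_to_S3 \<in> spheroids (top_of_set S2) y0"
  proof -
    have "?P \<circ> cube_to_S3 \<in> spheroids (top_of_set S3) (1, 0)"
      using qpow_spheroids[OF cube_to_S3_spheroid] qcnj_spheroids[OF qpow_spheroids[OF cube_to_S3_spheroid]]
      by (cases "n < 0") (simp_all add: o_def)
    from compose_spheroids[OF this h] show ?thesis
      by (simp add: y0_def o_assoc)
  qed
  ultimately have "(h \<circ> ?P) \<circ> cube_to_S3 \<in> ?A"
    by (simp only: cube_class_def mem_Collect_eq cube_homotopic_refl)
  \<comment> \<open>Membership in \<open>free_class\<close> allows a free homotopy before composing
    with \<open>cube_to_S3\<close>, so \<open>hom\<close> carries no base point condition.\<close>
  with hom show "h \<circ> twist_power n \<in> free_class (top_of_set S2) ?A"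
    unfolding free_class_def by (intro CollectI exI[of _ "h \<circ> ?P"] conjI)
  have fibre: "h z = y0 \<longleftrightarrow> snd z = 0" if "z \<in> S3" for z
  proof -
    have "inj_on \<iota> (hopf_orbit ` S3)"
      using homeomorphic_imp_injective_map[OF identification] by (simp add: topspace_orbit_space)
    then have "h z = y0 \<longleftrightarrow> hopf_orbit z = hopf_orbit (1, 0)"
      unfolding h_def y0_def o_apply by (rule inj_on_eq_iff) (use that in auto)
    then show ?thesis
      using hopf_orbit_eq_base_iff[OF that] by simp
  qed
  have "(h \<circ> twist_power n) z = y0 \<longleftrightarrow> snd z = 0" if "z \<in> S3" for z
  proof -
    \<comment> \<open>A twist preserves the modulus of the second coordinate, hence its zero
      set.\<close>
    have "snd (twist_power n z) = 0 \<longleftrightarrow> snd z = 0"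
      using cmod_snd_twist[of "\<lambda>w. w powi n" z, OF cmod_powi] by (metis norm_eq_zero)
    then show ?thesis
      using fibre[OF twist_power_in_S3[OF that, of n]] by simp
  qed
  then have "{z \<in> S3. (h \<circ> twist_power n) z = y0} = {z \<in> S3. snd z = 0}"
    by (intro Collect_cong conj_cong refl)
  also have "\<dots> = {(z1, 0) | z1. cmod z1 = 1}"
    by (auto simp: S3_iff abs_square_eq_1)
  finally show "{z \<in> S3. (h \<circ> twist_power n) z = y0} = {(z1, 0) | z1. cmod z1 = 1}" .
qed

end
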